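(* Consider the problem $\min_{x\in\mathcal{Q}}\Phi(x)$ with $\Phi=F+h$, $F=\sum_{n=1}^N f_n$, and a Legendre function $w$ with $\mathcal{Q}=\overline{\mathrm{dom}\,w}$, as set up in the context. Suppose that assumptions B1, B2, B3 and B4 (stated in the context) hold. Let $\{x_k\}$ be generated by the PLIAG method (described in the context) with delays bounded by $\tau$ and with constant step size $\alpha_k\equiv\alpha$. Let $L:=\max_{k\ge 0}\sum_{j\in J_k}L_j$, where the $L_j$ are the constants in B1, and suppose $$0<\alpha\le\alpha_0:=\frac{\left(1+\frac{\mu}{L}\frac{1}{\ell(\tau+1)}\right)^{\frac{1}{\tau+1}}-1}{\mu},$$ where $\mu$ is the constant in B3 and $\ell$ is the function in B4. Define $$\Gamma_\alpha(x):=\Phi(x)-\Phi^*+\frac{1}{\alpha}\inf_{z\in\mathcal{X}}D_w(z,x).$$ Then $$\Gamma_\alpha(x_k)\le\left(\frac{1}{1+\alpha\mu}\right)^k\Gamma_\alpha(x_0),\qquad\forall k\ge 0.$$ In particular, $$\Phi(x_k)-\Phi^*\le\left(\frac{1}{1+\alpha\mu}\right)^k\Gamma_\alpha(x_0),\qquad\forall k\ge 0,$$ and $$\inf_{z\in\mathcal{X}}D_w(z,x_k)\le\alpha\,\Gamma_\alpha(x_0)\left(\frac{1}{1+\alpha\mu}\right)^{k+1},\qquad\forall k\ge 0.$$ Furthermore, if $\alpha=\alpha_0$, then, with $Q:=L/\mu$, $$\Gamma_{\alpha_0}(x_k)\le\left(1-\frac{1}{[\ell(\tau+1)Q+1](\tau+1)}\right)^k\Gamma_{\alpha_0}(x_0),\qquad\forall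 k\ge 0.$$
   Context: Problem: $\mathcal{Q}\subseteq\mathbb{R}^d$ is a nonempty closed convex set with nonempty interior; $F=\sum_{n=1}^N f_n$ with each $f_n$ convex; $h:\mathbb{R}^d\to(-\infty,\infty]$ is proper, lower semicontinuous (lsc) and convex; $\Phi=F+h$. $\mathcal{X}$ is the set of minimizers of $\Phi$ over $\mathcal{Q}$, assumed nonempty and compact, and $\Phi^*$ is the optimal value. $\mathcal{N}=\{1,\dots,N\}$. Legendre function: a proper lsc convex $w:\mathbb{R}^d\to(-\infty,\infty]$ is of Legendre type if $\mathrm{int}\,\mathrm{dom}\,w\ne\emptyset$, $w$ is differentiable on $\mathrm{int}\,\mathrm{dom}\,w$, $\|\nabla w(y_k)\|\to\infty$ for every sequence $\{y_k\}\subseteq\mathrm{int}\,\mathrm{dom}\,w$ converging to a boundary point of $\mathrm{dom}\,w$, and $w$ is strictly convex on $\mathrm{int}\,\mathrm{dom}\,w$. $w$ is a Legendre function with $\mathcal{Q}=\overline{\mathrm{dom}\,w}$. The Bregman distance is $D_w(y,x)=w(y)-w(x)-\langle\nabla w(x),y-x\rangle$ for $y\in\mathrm{dom}\,w$, $x\in\mathrm{int}\,\mathrm{dom}\,w$ (and $+\infty$ if $y\notin\mathrm{dom}\,w$). PLIAG method: $x_0\in\mathrm{int}\,\mathrm{dom}\,w$, $x_k=x_0$ for $k<0$. For each $k\ge 0$ choose $\alpha_k>0$, a nonempty set $J_k\subseteq\mathcal{N}$ with complement $I_k=\mathcal{N}\setminus J_k$, and delays $\tau_k^n\in\{0,1,\dots,\tau\}$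 for $n\in\mathcal{N}$, where the integer $\tau\ge 0$ is the smallest upper bound of all delays; then (with $x_k\in\mathrm{int}\,\mathrm{dom}\,w$) $$x_{k+1}=\arg\min_{x\in\mathcal{Q}}\Big\{h(x)+\sum_{i\in I_k}f_i(x)+\Big\langle\sum_{j\in J_k}\nabla f_j(x_{k-\tau_k^j}),x\Big\rangle+\frac{1}{\alpha_k}D_w(x,x_k)\Big\}.$$ Assumptions: B1. Each $f_n:\mathbb{R}^d\to(-\infty,\infty]$ is proper lsc convex with $\mathrm{dom}\,w\subseteq\mathrm{dom}\,f_n$ and is differentiable on $\mathrm{int}\,\mathrm{dom}\,w$; moreover for each $n\in\mathcal{N}$ there is $L_n>0$ such that $L_nw-f_n$ is convex on $\mathrm{int}\,\mathrm{dom}\,w$. B2. $\mathrm{dom}\,h\cap\mathrm{int}\,\mathrm{dom}\,w\ne\emptyset$, and $\partial h(x)\neq\emptyset$ for all $x\in\mathrm{dom}\,h\cap\mathrm{int}\,\mathrm{dom}\,w$. B3 (Bregman distance growth condition). There is $\mu>0$ such that $\Phi(y)-\Phi^*\ge\mu\inf_{z\in\mathcal{X}}D_w(z,y)$ for all $y\in\mathrm{int}\,\mathrm{dom}\,w$ (this implicitly assumes $\mathcal{X}\cap\mathrm{dom}\,w\ne\emptyset$). B4. If $\tau>0$, there is a monotonically increasing function $\ell(\cdot)$ with $\ell(1)=1$ such that for any sequence $\{v_1,\dots,v_k\}\subseteq\mathrm{int}\,\mathrm{dom}\,w$, $D_w(v_k,v_j)\le\ell(k-j)\sum_{i=j}^{k-1}D_w(v_{i+1},v_i)$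 for all $j\ge 1$, $k>j+1$. (If $\tau=0$, only the value $\ell(1)=1$ is used.) *)

theory Defs
  imports "HOL-Analysis.Analysis"
begin

section \<open>Extended-valued convex functions\<close>

definition edom :: "('a \<Rightarrow> ereal) \<Rightarrow> 'a set" where
  "edom f = {x. f x < \<infinity>}"

definition eproper :: "('a \<Rightarrow> ereal) \<Rightarrow> bool" where
  "eproper f \<longleftrightarrow> (\<forall>x. f x \<noteq> -\<infinity>) \<and> edom f \<noteq> {}"

definition lsc :: "('a::topological_space \<Rightarrow> ereal) \<Rightarrow> bool" where
  "lsc f \<longleftrightarrow> (\<forall>x. f x \<le> Liminf (at x) f)"

text \<open>Intended for functions that never take the value \<open>-\<infinity>\<close>, so that
  \<open>\<infinity> - \<infinity>\<close> does not occur on the right-hand side.\<close>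

definition econvex :: "('a::real_vector \<Rightarrow> ereal) \<Rightarrow> bool" where
  "econvex f \<longleftrightarrow> (\<forall>x y. \<forall>t\<in>{0..1}.
     f ((1 - t) *\<^sub>R x + t *\<^sub>R y) \<le> ereal (1 - t) * f x + ereal t * f y)"

definition proper_lsc_convex :: "('a::real_normed_vector \<Rightarrow> ereal) \<Rightarrow> bool" where
  "proper_lsc_convex f \<longleftrightarrow> eproper f \<and> lsc f \<and> econvex f"

definition subdifferential :: "('a::real_inner \<Rightarrow> ereal) \<Rightarrow> 'a \<Rightarrow> 'a set" where
  "subdifferential f x = {g. \<forall>y. f x + ereal (g \<bullet> (y - x)) \<le> f y}"

text \<open>Differentiability and gradients are those of the real-valued function
  \<open>real_of_ereal \<circ> f\<close>. They are only used at interior points of the domain of a proper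
  function, where \<open>f\<close> is finite on a neighbourhood.\<close>

definition ediff_on :: "('a::real_normed_vector \<Rightarrow> ereal) \<Rightarrow> 'a set \<Rightarrow> bool" where
  "ediff_on f S \<longleftrightarrow> (\<forall>x\<in>S. (\<lambda>y. real_of_ereal (f y)) differentiable (at x))"

definition grad :: "('a::real_inner \<Rightarrow> ereal) \<Rightarrow> 'a \<Rightarrow> 'a" where
  "grad f x = (THE g. GDERIV (\<lambda>y. real_of_ereal (f y)) x :> g)"


section \<open>Legendre functions and Bregman distances\<close>

definition legendre :: "('a::real_inner \<Rightarrow> ereal) \<Rightarrow> bool" where
  "legendre w \<longleftrightarrow> proper_lsc_convex w \<and>
     interior (edom w) \<noteq> {} \<and>
     ediff_on w (interior (edom w)) \<and>
     (\<forall>(y :: nat \<Rightarrow> 'a) b. (\<forall>k. y k \<in> interior (edom w)) \<longrightarrow> b \<in> frontier (edom w) \<longrightarrow>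
        y \<longlonglongrightarrow> b \<longrightarrow> filterlim (\<lambda>k. norm (grad w (y k))) at_top sequentially) \<and>
     (\<forall>x\<in>interior (edom w). \<forall>y\<in>interior (edom w). \<forall>t\<in>{0<..<1}. x \<noteq> y \<longrightarrow>
        w ((1 - t) *\<^sub>R x + t *\<^sub>R y) < ereal (1 - t) * w x + ereal t * w y)"

text \<open>\<open>bregman w y x\<close> is meaningful for \<open>x \<in> interior (edom w)\<close>; there \<open>w x\<close> is
  finite, and the value is \<open>\<infinity>\<close> whenever \<open>y \<notin> edom w\<close>, since then \<open>w y = \<infinity>\<close>.\<close>

definition bregman :: "('a::real_inner \<Rightarrow> ereal) \<Rightarrow> 'a \<Rightarrow> 'a \<Rightarrow> ereal" where
  "bregman w y x = w y - w x - ereal (grad w x \<bullet> (y - x))"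


section \<open>The composite problem\<close>

definition Phi :: "nat \<Rightarrow> (nat \<Rightarrow> 'a \<Rightarrow> ereal) \<Rightarrow> ('a \<Rightarrow> ereal) \<Rightarrow> 'a \<Rightarrow> ereal" where
  "Phi N f h x = (\<Sum>n\<in>{1..N}. f n x) + h x"

definition opt_value :: "'a set \<Rightarrow> ('a \<Rightarrow> ereal) \<Rightarrow> ereal" where
  "opt_value Q \<Phi> = (INF x\<in>Q. \<Phi> x)"

definition minimizers :: "'a set \<Rightarrow> ('a \<Rightarrow> ereal) \<Rightarrow> 'a set" where
  "minimizers Q \<Phi> = {x. is_arg_min \<Phi> (\<lambda>y. y \<in> Q) x}"

definition breg_dist_to :: "('a::real_inner \<Rightarrow> ereal) \<Rightarrow> 'a set \<Rightarrow> 'a \<Rightarrow> ereal" where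
  "breg_dist_to w X x = (INF z\<in>X. bregman w z x)"


section \<open>Assumptions\<close>

definition assm_B1 ::
  "nat \<Rightarrow> (nat \<Rightarrow> 'a::euclidean_space \<Rightarrow> ereal) \<Rightarrow> ('a \<Rightarrow> ereal) \<Rightarrow> (nat \<Rightarrow> real) \<Rightarrow> bool" where
  "assm_B1 N f w Ls \<longleftrightarrow> (\<forall>n\<in>{1..N}.
     proper_lsc_convex (f n) \<and> edom w \<subseteq> edom (f n) \<and> ediff_on (f n) (interior (edom w)) \<and>
     Ls n > 0 \<and>
     convex_on (interior (edom w)) (\<lambda>x. Ls n * real_of_ereal (w x) - real_of_ereal (f n x)))"

definition assm_B2 :: "('a::euclidean_space \<Rightarrow> ereal) \<Rightarrow> ('a \<Rightarrow> ereal) \<Rightarrow> bool" where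
  "assm_B2 h w \<longleftrightarrow> edom h \<inter> interior (edom w) \<noteq> {} \<and>
     (\<forall>x\<in>edom h \<inter> interior (edom w). subdifferential h x \<noteq> {})"

definition assm_B3 ::
  "'a::euclidean_space set \<Rightarrow> ('a \<Rightarrow> ereal) \<Rightarrow> ('a \<Rightarrow> ereal) \<Rightarrow> real \<Rightarrow> bool" where
  "assm_B3 Q \<Phi> w \<mu> \<longleftrightarrow> \<mu> > 0 \<and>
     (\<forall>y\<in>interior (edom w).
        \<Phi> y - opt_value Q \<Phi> \<ge> ereal \<mu> * breg_dist_to w (minimizers Q \<Phi>) y)"

text \<open>Only the values of \<open>l\<close> at positive integers matter, so \<open>l\<close> is a function on
  \<open>nat\<close> that is unconstrained at \<open>0\<close>. For \<open>\<tau> = 0\<close> nothing but \<open>l 1 = 1\<close> is required.\<close>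

definition assm_B4 :: "('a::euclidean_space \<Rightarrow> ereal) \<Rightarrow> nat \<Rightarrow> (nat \<Rightarrow> real) \<Rightarrow> bool" where
  "assm_B4 w \<tau> l \<longleftrightarrow> l 1 = 1 \<and>
     (\<tau> > 0 \<longrightarrow> mono_on {1..} l \<and>
        (\<forall>(v :: nat \<Rightarrow> 'a) k j. (\<forall>i\<in>{1..k}. v i \<in> interior (edom w)) \<longrightarrow> 1 \<le> j \<longrightarrow> j + 1 < k \<longrightarrow>
           bregman w (v k) (v j) \<le>
             ereal (l (k - j)) * (\<Sum>i\<in>{j..k - 1}. bregman w (v (i + 1)) (v i))))"


section \<open>The PLIAG method\<close>

text \<open>In iteration \<open>k\<close>, \<open>a k\<close> is the step size and \<open>d k n\<close> the delay of component \<open>n\<close>.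
  The truncated subtraction \<open>k - d k j\<close> on \<open>nat\<close> implements the convention
  \<open>x\<^sub>k = x\<^sub>0\<close> for \<open>k < 0\<close>.\<close>

definition pliag_objective ::
  "nat \<Rightarrow> (nat \<Rightarrow> 'a::euclidean_space \<Rightarrow> ereal) \<Rightarrow> ('a \<Rightarrow> ereal) \<Rightarrow> ('a \<Rightarrow> ereal) \<Rightarrow>
   (nat \<Rightarrow> real) \<Rightarrow> (nat \<Rightarrow> nat set) \<Rightarrow> (nat \<Rightarrow> nat \<Rightarrow> nat) \<Rightarrow> (nat \<Rightarrow> 'a) \<Rightarrow> nat \<Rightarrow> 'a \<Rightarrow> ereal" where
  "pliag_objective N f h w a J d x k y =
     h y + (\<Sum>i\<in>{1..N} - J k. f i y)
     + ereal ((\<Sum>j\<in>J k. grad (f j) (x (k - d k j))) \<bullet> y)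
     + ereal (1 / a k) * bregman w y (x k)"

text \<open>\<open>\<tau>\<close> is the least upper bound of all delays. That the iterates \<open>x k\<close>, \<open>k > 0\<close>, stay in
  \<open>interior (edom w)\<close> is not imposed: it follows from optimality, because \<open>w\<close> is of Legendre
  type and \<open>edom h\<close> meets \<open>interior (edom w)\<close>.\<close>

definition pliag ::
  "'a::euclidean_space set \<Rightarrow> nat \<Rightarrow> (nat \<Rightarrow> 'a \<Rightarrow> ereal) \<Rightarrow> ('a \<Rightarrow> ereal) \<Rightarrow> ('a \<Rightarrow> ereal) \<Rightarrow> nat \<Rightarrow>
   (nat \<Rightarrow> real) \<Rightarrow> (nat \<Rightarrow> nat set) \<Rightarrow> (nat \<Rightarrow> nat \<Rightarrow> nat) \<Rightarrow> (nat \<Rightarrow> 'a) \<Rightarrow> bool" where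
  "pliag Q N f h w \<tau> a J d x \<longleftrightarrow>
     x 0 \<in> interior (edom w) \<and>
     (\<forall>k. a k > 0) \<and>
     (\<forall>k. J k \<noteq> {} \<and> J k \<subseteq> {1..N}) \<and>
     (\<forall>k. \<forall>n\<in>{1..N}. d k n \<le> \<tau>) \<and>
     (\<forall>s. (\<forall>k. \<forall>n\<in>{1..N}. d k n \<le> s) \<longrightarrow> \<tau> \<le> s) \<and>
     (\<forall>k. is_arg_min (pliag_objective N f h w a J d x k) (\<lambda>y. y \<in> Q) (x (Suc k)))"

definition Gam ::
  "'a::euclidean_space set \<Rightarrow> ('a \<Rightarrow> ereal) \<Rightarrow> ('a \<Rightarrow> ereal) \<Rightarrow> real \<Rightarrow> 'a \<Rightarrow> ereal" where
  "Gam Q \<Phi> w \<alpha> x =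
     \<Phi> x - opt_value Q \<Phi> + ereal (1 / \<alpha>) * breg_dist_to w (minimizers Q \<Phi>) x"

end

theory Submission
  imports Defs
begin

text \<open>
  The gradient blow-up of \<open>w\<close> at the boundary keeps every iterate in the interior of its domain. There the
  optimality of a step and the three-point identity for \<open>D\<^sub>w\<close>, combined with the relative
  smoothness of the linearized components, bound \<open>\<Gamma>(x\<^sub>k\<^sub>+\<^sub>1)\<close> by \<open>\<alpha>\<^sup>-\<^sup>1\<close> times the
  distance of \<open>x\<^sub>k\<close> to the solution set, minus \<open>\<alpha>\<^sup>-\<^sup>1 \<Delta>\<^sub>k\<close> with
  \<open>\<Delta>\<^sub>k = D\<^sub>w(x\<^sub>k\<^sub>+\<^sub>1, x\<^sub>k)\<close>, plus \<open>L \<ell>(\<tau> + 1)\<close> times the sum of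
  \<open>\<Delta>\<^sub>i\<close> over the last \<open>\<tau> + 1\<close> steps. By the growth condition the first term is at most
  \<open>\<theta> \<Gamma>(x\<^sub>k)\<close> with \<open>\<theta> = 1 / (1 + \<alpha>\<mu>)\<close>. After division by \<open>\<theta>\<^sup>k\<^sup>+\<^sup>1\<close> and
  summation, the coefficient of each \<open>\<Delta>\<^sub>i\<close> is nonpositive as soon as
  \<open>L \<ell>(\<tau> + 1) (1 + \<theta>\<^sup>-\<^sup>1 + \<dots> + \<theta>\<^sup>-\<^sup>\<tau>) \<le> \<alpha>\<^sup>-\<^sup>1\<close>, and summing the geometric series
  turns this into \<open>\<alpha> \<le> \<alpha>\<^sub>0\<close>. The rate at \<open>\<alpha>\<^sub>0\<close> is then Bernoulli's inequality.
\<close>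

section \<open>Gradients and convexity\<close>

text \<open>The limit is taken from the right, because the convexity inequalities that feed it
  control difference quotients only for t in (0,1).\<close>

lemma GDERIV_directional_limit:
  fixes g :: "'a::real_inner \<Rightarrow> real"
  assumes "GDERIV g x :> v"
  shows "((\<lambda>t. (g (x + t *\<^sub>R u) - g x) / t) \<longlongrightarrow> v \<bullet> u) (at_right 0)"
proof -
  have "(g has_derivative (\<lambda>h. h \<bullet> v)) (at x)"
    using assms by (simp add: gderiv_def)
  then have g: "(g has_derivative (\<lambda>h. h \<bullet> v)) (at (x + 0 *\<^sub>R u))"
    by simp
  have "((\<lambda>t. x + t *\<^sub>R u) has_derivative (\<lambda>t. t *\<^sub>R u)) (at (0::real))"
    by (auto intro!: derivative_eq_intros)
  from has_derivative_compose[OF this g]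
  have "((\<lambda>t. g (x + t *\<^sub>R u)) has_derivative (\<lambda>t. t * (v \<bullet> u))) (at (0::real))"
    by (simp add: inner_commute)
  then have "((\<lambda>t. g (x + t *\<^sub>R u)) has_real_derivative v \<bullet> u) (at 0)"
    by (simp add: has_field_derivative_def mult_commute_abs)
  then have "((\<lambda>t. (g (x + t *\<^sub>R u) - g x) / t) \<longlongrightarrow> v \<bullet> u) (at 0)"
    by (simp add: has_field_derivative_iff)
  then show ?thesis
    by (rule tendsto_within_subset) simp
qed

lemma eventually_at_right_0_less_1: "eventually (\<lambda>t::real. 0 < t \<and> t < 1) (at_right 0)"
  using eventually_at_right_real[of 0 1] by simp

lemma GDERIV_inner_ge:
  fixes g :: "'a::real_inner \<Rightarrow> real"
  assumes "GDERIV g x :> v"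
    and "\<And>t. 0 < t \<Longrightarrow> t < 1 \<Longrightarrow> c * t \<le> g (x + t *\<^sub>R u) - g x"
  shows "c \<le> v \<bullet> u"
proof (rule tendsto_lowerbound[OF GDERIV_directional_limit[OF assms(1)]])
  show "\<forall>\<^sub>F t in at_right 0. c \<le> (g (x + t *\<^sub>R u) - g x) / t"
    using eventually_at_right_0_less_1
    by eventually_elim (use assms(2) in \<open>auto simp: field_simps\<close>)
qed simp

lemma GDERIV_inner_le:
  fixes g :: "'a::real_inner \<Rightarrow> real"
  assumes "GDERIV g x :> v"
    and "\<And>t. 0 < t \<Longrightarrow> t < 1 \<Longrightarrow> g (x + t *\<^sub>R u) - g x \<le> c * t"
  shows "v \<bullet> u \<le> c"
proof (rule tendsto_upperbound[OF GDERIV_directional_limit[OF assms(1)]])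
  show "\<forall>\<^sub>F t in at_right 0. (g (x + t *\<^sub>R u) - g x) / t \<le> c"
    using eventually_at_right_0_less_1
    by eventually_elim (use assms(2) in \<open>auto simp: field_simps\<close>)
qed simp

lemma convex_on_segment:
  fixes g :: "'a::real_vector \<Rightarrow> real"
  assumes "convex_on S g" "x \<in> S" "y \<in> S" "0 \<le> t" "t \<le> 1"
  shows "x + t *\<^sub>R (y - x) \<in> S" "g (x + t *\<^sub>R (y - x)) \<le> (1 - t) * g x + t * g y"
proof -
  have eq: "x + t *\<^sub>R (y - x) = (1 - t) *\<^sub>R x + t *\<^sub>R y"
    by (simp add: algebra_simps)
  have "convex S"
    using assms(1) by (simp add: convex_on_def)
  then show "x + t *\<^sub>R (y - x) \<in> S"
    unfolding eq using assms(2-5) by (simp add: convexD_alt)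
  show "g (x + t *\<^sub>R (y - x)) \<le> (1 - t) * g x + t * g y"
    unfolding eq using convex_onD[OF assms(1) assms(4,5,2,3)] .
qed

lemma convex_on_gradient_le:
  fixes g :: "'a::real_inner \<Rightarrow> real"
  assumes cvx: "convex_on S g" and xy: "x \<in> S" "y \<in> S" and v: "GDERIV g x :> v"
  shows "g x + v \<bullet> (y - x) \<le> g y"
proof -
  have "v \<bullet> (y - x) \<le> g y - g x"
  proof (rule GDERIV_inner_le[OF v])
    fix t :: real assume "0 < t" "t < 1"
    then show "g (x + t *\<^sub>R (y - x)) - g x \<le> (g y - g x) * t"
      using convex_on_segment(2)[OF cvx xy, of t] by (simp add: algebra_simps)
  qed
  then show ?thesis by simp
qed

lemma differentiable_imp_GDERIV:
  fixes g :: "'a::euclidean_space \<Rightarrow> real"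
  assumes "g differentiable (at x)"
  shows "\<exists>v. GDERIV g x :> v"
proof -
  obtain g' where g': "(g has_derivative g') (at x)"
    using assms by (auto simp: differentiable_def)
  then have lin: "linear g'"
    by (rule has_derivative_linear)
  have "g' = (\<lambda>h. h \<bullet> adjoint g' 1)"
    using adjoint_works[OF lin, of _ 1] by (auto simp: inner_commute)
  with g' have "GDERIV g x :> adjoint g' 1"
    unfolding gderiv_def by metis
  then show ?thesis ..
qed

text \<open>\<open>grad\<close> is a definite description, so existence and uniqueness of the
  gradient are both required before it denotes anything.\<close>

lemma GDERIV_grad:
  fixes f :: "'a::euclidean_space \<Rightarrow> ereal"
  assumes "ediff_on f S" "x \<in> S"
  shows "GDERIV (\<lambda>y. real_of_ereal (f y)) x :> grad f x"
proof -
  obtain v where v: "GDERIV (\<lambda>y. real_of_ereal (f y)) x :> v"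
    using differentiable_imp_GDERIV assms unfolding ediff_on_def by blast
  have uniq: "v' = v" if "GDERIV (\<lambda>y. real_of_ereal (f y)) x :> v'" for v'
  proof -
    have "(\<lambda>h. h \<bullet> v') = (\<lambda>h. h \<bullet> v)"
      using has_derivative_unique that v unfolding gderiv_def by blast
    then have "h \<bullet> v' = h \<bullet> v" for h
      by metis
    then show ?thesis
      by (metis vector_eq_ldot)
  qed
  show ?thesis
    unfolding grad_def by (rule theI[where P = "\<lambda>g. GDERIV (\<lambda>y. real_of_ereal (f y)) x :> g", OF v]) (rule uniq)
qed

lemma eproper_edom:
  assumes "eproper f" "x \<in> edom f"
  shows "f x = ereal (real_of_ereal (f x))"
  using assms unfolding eproper_def edom_def by (cases "f x") auto

lemma econvex_imp_convex_on:
  fixes f :: "'a::real_vector \<Rightarrow> ereal"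
  assumes p: "eproper f" and c: "econvex f"
  shows "convex_on (edom f) (\<lambda>x. real_of_ereal (f x))"
proof (rule convex_onI)
  have *: "f ((1 - t) *\<^sub>R x + t *\<^sub>R y) \<le> ereal ((1 - t) * real_of_ereal (f x) + t * real_of_ereal (f y))"
    if "x \<in> edom f" "y \<in> edom f" "0 \<le> t" "t \<le> 1" for x y and t :: real
  proof -
    have "f ((1 - t) *\<^sub>R x + t *\<^sub>R y) \<le> ereal (1 - t) * f x + ereal t * f y"
      using c that unfolding econvex_def by auto
    also have "\<dots> = ereal (1 - t) * ereal (real_of_ereal (f x)) + ereal t * ereal (real_of_ereal (f y))"
      using eproper_edom[OF p that(1)] eproper_edom[OF p that(2)] by simp
    finally show ?thesis by simp
  qed
  \<comment> \<open>The finite upper bound on the value keeps the whole segment inside the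
    domain.\<close>
  have dom: "(1 - t) *\<^sub>R x + t *\<^sub>R y \<in> edom f"
    if "x \<in> edom f" "y \<in> edom f" "0 \<le> t" "t \<le> 1" for x y and t :: real
    using *[OF that] by (auto simp: edom_def less_top[symmetric] top_ereal_def)
  show "convex (edom f)"
    unfolding convex_alt using dom by auto
  fix t :: real and x y assume a: "0 < t" "t < 1" "x \<in> edom f" "y \<in> edom f"
  then have "ereal (real_of_ereal (f ((1 - t) *\<^sub>R x + t *\<^sub>R y)))
      \<le> ereal ((1 - t) * real_of_ereal (f x) + t * real_of_ereal (f y))"
    using *[of x y t] eproper_edom[OF p dom[of x y t]] by simp
  then show "real_of_ereal (f ((1 - t) *\<^sub>R x + t *\<^sub>R y))
      \<le> (1 - t) * real_of_ereal (f x) + t * real_of_ereal (f y)" by simp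
qed


section \<open>The proximal step\<close>

text \<open>At a boundary minimizer \<open>p\<close> the gradient blow-up makes the slope of \<open>W\<close> from \<open>p\<close> towards an
  interior point \<open>q\<close> equal to \<open>-\<infinity>\<close>: a ball around \<open>q\<close> on which \<open>W\<close> is bounded turns the growth of
  the gradient norm into decrease along the segment, while \<open>\<psi>\<close> has bounded slope there.\<close>

lemma prox_point_in_interior:
  fixes W \<psi> :: "'a::euclidean_space \<Rightarrow> real" and G :: "'a \<Rightarrow> 'a"
  assumes W: "convex_on C W"
    and G: "\<And>y. y \<in> interior C \<Longrightarrow> GDERIV W y :> G y"
    and blow: "\<And>(y::nat \<Rightarrow> 'a) b. (\<And>k. y k \<in> interior C) \<Longrightarrow> b \<in> frontier C \<Longrightarrow> y \<longlonglongrightarrow> b \<Longrightarrow>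
        filterlim (\<lambda>k. norm (G (y k))) at_top sequentially"
    and \<psi>: "convex_on D \<psi>"
    and p: "p \<in> C" "p \<in> D" and q: "q \<in> interior C" "q \<in> D"
    and min: "\<And>y. y \<in> C \<Longrightarrow> y \<in> D \<Longrightarrow> \<psi> p + W p \<le> \<psi> y + W y"
  shows "p \<in> interior C"
proof (rule ccontr)
  assume "p \<notin> interior C"
  with p have pf: "p \<in> frontier C"
    by (simp add: frontier_def closure_subset[THEN subsetD])
  have cC: "convex C" using W by (simp add: convex_on_def)
  have qC: "q \<in> C" using q interior_subset by blast
  \<comment> \<open>The points \<open>y k\<close> run along the segment from \<open>q\<close> to
    \<open>p\<close>. A positive weight on the interior point \<open>q\<close> makes each of them
    interior, and \<open>t k\<close> tending to 0 makes them approach \<open>p\<close>.\<close>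
  define t where "t k = inverse (real (k + 2))" for k
  define y where "y k = p + t k *\<^sub>R (q - p)" for k
  have t: "0 < t k" "t k \<le> 1/2" for k
    by (auto simp: t_def field_simps)
  then have t': "0 \<le> t k" "t k \<le> 1" for k
    by (simp_all add: less_imp_le order_trans[of _ "1/2"])
  have t0: "t \<longlonglongrightarrow> 0"
    unfolding t_def using LIMSEQ_ignore_initial_segment[OF LIMSEQ_inverse_real_of_nat, of 1]
    by (simp add: algebra_simps)
  have "y k \<in> interior C" for k
  proof -
    have "p - t k *\<^sub>R (p - q) \<in> interior C"
      by (rule mem_interior_convex_shrink[OF cC q(1) p(1)]) (use t' t in auto)
    then show ?thesis by (simp add: y_def algebra_simps)
  qed
  note yint = this
  have yC: "y k \<in> C" for k using yint interior_subset by blast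
  have "y \<longlonglongrightarrow> p + 0 *\<^sub>R (q - p)"
    unfolding y_def by (intro tendsto_intros t0)
  then have "y \<longlonglongrightarrow> p" by simp
  from blow[OF yint pf this]
  have lim: "filterlim (\<lambda>k. norm (G (y k))) at_top sequentially" .
  obtain r where r: "r > 0" "cball q r \<subseteq> interior C"
    using q(1) open_contains_cball open_interior by blast
  have "continuous_on (cball q r) W"
  proof (rule continuous_at_imp_continuous_on, rule ballI)
    fix u assume "u \<in> cball q r"
    then have "GDERIV W u :> G u" using r G by blast
    then show "isCont W u"
      unfolding gderiv_def by (rule has_derivative_continuous)
  qed
  then have "bdd_above (W ` cball q r)"
    by (intro bounded_imp_bdd_above compact_imp_bounded compact_continuous_image) simp_all
  then obtain M where M: "\<forall>u\<in>cball q r. W u \<le> M"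
    unfolding bdd_above_def by auto
  \<comment> \<open>The supporting affine function of \<open>W\<close> at \<open>q\<close> bounds
    \<open>W\<close> from below; on the segment its values interpolate the two numbers under
    \<open>min\<close>.\<close>
  define m where "m = min (W q) (W q + G q \<bullet> (p - q))"
  have Wm: "W (y k) \<ge> m" for k
  proof -
    have "W (y k) \<ge> W q + G q \<bullet> (y k - q)"
      by (rule convex_on_gradient_le[OF W qC yC G[OF q(1)]])
    moreover have "y k - q = (1 - t k) *\<^sub>R (p - q)"
      by (simp add: y_def algebra_simps)
    ultimately have "W (y k) \<ge> t k * W q + (1 - t k) * (W q + G q \<bullet> (p - q))"
      by (simp add: algebra_simps)
    moreover have "t k * W q + (1 - t k) * (W q + G q \<bullet> (p - q)) \<ge> t k * m + (1 - t k) * m"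
      by (intro add_mono mult_left_mono) (use t' in \<open>auto simp: m_def\<close>)
    ultimately show ?thesis by (simp add: algebra_simps)
  qed
  \<comment> \<open>Comparing \<open>p\<close> with \<open>y k\<close> bounds W(p) - W(y k) from
    above, and the gradient inequality at \<open>y k\<close> bounds it from below. Both bounds are
    proportional to \<open>t k\<close>, which cancels.\<close>
  have slope: "G (y k) \<bullet> (q - p) \<ge> \<psi> p - \<psi> q" for k
  proof -
    have "y k \<in> D" "\<psi> (y k) \<le> (1 - t k) * \<psi> p + t k * \<psi> q"
      unfolding y_def using convex_on_segment[OF \<psi> p(2) q(2) t'] by auto
    with min[OF yC] have "W p - W (y k) \<le> t k * (\<psi> q - \<psi> p)"
      by (fastforce simp: algebra_simps)
    moreover have "W (y k) + G (y k) \<bullet> (p - y k) \<le> W p"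
      by (rule convex_on_gradient_le[OF W yC p(1) G[OF yint]])
    moreover have "p - y k = - t k *\<^sub>R (q - p)"
      by (simp add: y_def)
    ultimately have "t k * (\<psi> p - \<psi> q) \<le> t k * (G (y k) \<bullet> (q - p))"
      by (simp add: algebra_simps)
    then show ?thesis using t by simp
  qed
  have bound: "r * norm (G (y k)) \<le> M - m + \<bar>\<psi> p - \<psi> q\<bar>" for k
  proof -
    \<comment> \<open>Moving from \<open>q\<close> in the gradient direction turns the gradient
      inequality into a bound on r times the gradient norm. For a zero gradient \<open>sgn\<close>
      is 0, and \<open>u\<close> is just \<open>q\<close>.\<close>
    define u where "u = q + r *\<^sub>R sgn (G (y k))"
    have ub: "u \<in> cball q r"
      using r(1) by (simp add: u_def dist_norm norm_sgn)
    then have uC: "u \<in> C" using r interior_subset by blast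
    have "W (y k) + G (y k) \<bullet> (u - y k) \<le> W u"
      by (rule convex_on_gradient_le[OF W yC uC G[OF yint]])
    moreover have "u - y k = (1 - t k) *\<^sub>R (q - p) + r *\<^sub>R sgn (G (y k))"
      by (simp add: u_def y_def algebra_simps)
    moreover have "G (y k) \<bullet> sgn (G (y k)) = norm (G (y k))"
      by (cases "G (y k) = 0") (simp_all add: sgn_div_norm dot_square_norm power2_eq_square)
    ultimately have *: "W (y k) + (1 - t k) * (G (y k) \<bullet> (q - p)) + r * norm (G (y k)) \<le> M"
      using bspec[OF M ub] by (simp add: inner_add_right)
    have "\<bar>(1 - t k) * (\<psi> p - \<psi> q)\<bar> \<le> 1 * \<bar>\<psi> p - \<psi> q\<bar>"
      unfolding abs_mult by (intro mult_right_mono) (use t' in auto)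
    then have "- \<bar>\<psi> p - \<psi> q\<bar> \<le> (1 - t k) * (\<psi> p - \<psi> q)"
      by (simp only: mult_1 abs_le_iff minus_le_iff)
    also have "\<dots> \<le> (1 - t k) * (G (y k) \<bullet> (q - p))"
      using slope t' by (intro mult_left_mono) auto
    finally have "- \<bar>\<psi> p - \<psi> q\<bar> \<le> (1 - t k) * (G (y k) \<bullet> (q - p))" .
    then show ?thesis using * Wm[of k] by simp
  qed
  have "\<forall>\<^sub>F k in sequentially. norm (G (y k)) > (M - m + \<bar>\<psi> p - \<psi> q\<bar>) / r"
    using lim by (simp add: filterlim_at_top_dense)
  then obtain k where "norm (G (y k)) > (M - m + \<bar>\<psi> p - \<psi> q\<bar>) / r"
    by (auto simp: eventually_sequentially)
  then show False using bound[of k] r(1) by (simp add: field_simps)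
qed

text \<open>On the segment from \<open>p\<close> to \<open>z\<close>, minimality makes
  \<open>W\<close> grow at least as fast as \<psi> falls, and convexity bounds the fall of \<psi> by
  its chord. Only \<open>W\<close> is differentiated, so \<psi> may be nonsmooth.\<close>

lemma prox_variational_inequality:
  fixes W \<psi> :: "'a::real_inner \<Rightarrow> real"
  assumes W: "convex_on C W" and G: "GDERIV W p :> v" and \<psi>: "convex_on D \<psi>"
    and p: "p \<in> C" "p \<in> D" and z: "z \<in> C" "z \<in> D"
    and min: "\<And>y. y \<in> C \<Longrightarrow> y \<in> D \<Longrightarrow> \<psi> p + W p \<le> \<psi> y + W y"
  shows "\<psi> p - \<psi> z \<le> v \<bullet> (z - p)"
proof (rule GDERIV_inner_ge[OF G])
  fix t :: real assume t: "0 < t" "t < 1"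
  let ?y = "p + t *\<^sub>R (z - p)"
  have "?y \<in> C" using convex_on_segment(1)[OF W p(1) z(1)] t by simp
  moreover have "?y \<in> D" "\<psi> ?y \<le> (1 - t) * \<psi> p + t * \<psi> z"
    using convex_on_segment[OF \<psi> p(2) z(2), of t] t by auto
  ultimately show "(\<psi> p - \<psi> z) * t \<le> W ?y - W p"
    using min[of ?y] by (simp add: algebra_simps)
qed


section \<open>Scalar recursions and the step size\<close>

text \<open>Each \<Delta> i reappears in the windows of at most \<tau> + 1 steps, so its single
  negative occurrence must pay for a geometric sum of weights; this is what \<open>bc\<close>
  provides.\<close>

lemma delayed_recursion_linear_rate:
  fixes V \<Delta> :: "nat \<Rightarrow> real"
  assumes rec: "\<And>k. V (Suc k) \<le> \<theta> * V k - b * \<Delta> k + c * (\<Sum>i\<in>{k - \<tau>..k}. \<Delta> i)"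
    and \<Delta>: "\<And>k. 0 \<le> \<Delta> k" and \<theta>: "0 < \<theta>" and c: "0 \<le> c"
    and bc: "c * (\<Sum>m\<le>\<tau>. inverse \<theta> ^ m) \<le> b"
  shows "V k \<le> \<theta> ^ k * V 0"
proof -
  define r where "r = inverse \<theta>"
  have r: "r > 0" "r * \<theta> = 1" using \<theta> by (auto simp: r_def)
  \<comment> \<open>Weighting step j by r^(j+1) turns \<theta> V(j) into r^j V(j), so the V terms
    telescope.\<close>
  have tel: "r ^ k * V k \<le> V 0 + (\<Sum>j<k. r ^ Suc j * (c * (\<Sum>i\<in>{j - \<tau>..j}. \<Delta> i) - b * \<Delta> j))" for k
  proof (induction k)
    case (Suc k)
    have "r ^ Suc k * V (Suc k)
        \<le> r ^ Suc k * (\<theta> * V k - b * \<Delta> k + c * (\<Sum>i\<in>{k - \<tau>..k}. \<Delta> i))"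
      using rec[of k] r by (intro mult_left_mono) auto
    also have "\<dots> = r ^ k * V k * (r * \<theta>) + r ^ Suc k * (c * (\<Sum>i\<in>{k - \<tau>..k}. \<Delta> i) - b * \<Delta> k)"
      by (simp add: algebra_simps)
    finally show ?case using Suc r(2) by simp
  qed simp
  have "(\<Sum>j<k. r ^ Suc j * (\<Sum>i\<in>{j - \<tau>..j}. \<Delta> i))
      = (\<Sum>j<k. \<Sum>i | i \<in> {..<k} \<and> j - \<tau> \<le> i \<and> i \<le> j. r ^ Suc j * \<Delta> i)"
    unfolding sum_distrib_left by (intro sum.cong) auto
  also have "\<dots> = (\<Sum>i<k. \<Sum>j | j \<in> {..<k} \<and> j - \<tau> \<le> i \<and> i \<le> j. r ^ Suc j * \<Delta> i)"
    by (rule sum.swap_restrict) auto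
  \<comment> \<open>Dropping the cutoff j < k only adds nonnegative terms and makes the inner range
    independent of k.\<close>
  also have "\<dots> \<le> (\<Sum>i<k. \<Sum>j\<in>{i..i + \<tau>}. r ^ Suc j * \<Delta> i)"
    by (intro sum_mono sum_mono2) (use r \<Delta> in auto)
  also have "\<dots> = (\<Sum>i<k. r ^ Suc i * \<Delta> i * (\<Sum>m\<le>\<tau>. r ^ m))"
  proof (rule sum.cong)
    fix i
    have "(\<Sum>j\<in>{i..i + \<tau>}. r ^ Suc j * \<Delta> i) = (\<Sum>j\<in>{0 + i..\<tau> + i}. r ^ Suc j * \<Delta> i)"
      by (simp add: add.commute)
    also have "\<dots> = (\<Sum>m\<in>{0..\<tau>}. r ^ Suc (m + i) * \<Delta> i)"
      by (rule sum.shift_bounds_cl_nat_ivl)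
    also have "\<dots> = r ^ Suc i * \<Delta> i * (\<Sum>m\<le>\<tau>. r ^ m)"
      unfolding sum_distrib_left atLeast0AtMost by (intro sum.cong) (simp_all add: power_add)
    finally show "(\<Sum>j\<in>{i..i + \<tau>}. r ^ Suc j * \<Delta> i) = r ^ Suc i * \<Delta> i * (\<Sum>m\<le>\<tau>. r ^ m)" .
  qed simp
  finally have swap: "(\<Sum>j<k. r ^ Suc j * (\<Sum>i\<in>{j - \<tau>..j}. \<Delta> i))
      \<le> (\<Sum>i<k. r ^ Suc i * \<Delta> i * (\<Sum>m\<le>\<tau>. r ^ m))" .
  have "(\<Sum>j<k. r ^ Suc j * (c * sum \<Delta> {j - \<tau>..j} - b * \<Delta> j))
      = c * (\<Sum>j<k. r ^ Suc j * (\<Sum>i\<in>{j - \<tau>..j}. \<Delta> i)) - (\<Sum>j<k. r ^ Suc j * \<Delta> j * b)"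
    unfolding sum_distrib_left[of c] sum_subtractf[symmetric]
    by (intro sum.cong) (simp_all add: right_diff_distrib sum_distrib_left mult_ac)
  also have "\<dots> \<le> c * (\<Sum>i<k. r ^ Suc i * \<Delta> i * (\<Sum>m\<le>\<tau>. r ^ m)) - (\<Sum>j<k. r ^ Suc j * \<Delta> j * b)"
    using mult_left_mono[OF swap c] by simp
  also have "\<dots> = (\<Sum>i<k. r ^ Suc i * \<Delta> i * (c * (\<Sum>m\<le>\<tau>. r ^ m) - b))"
    unfolding sum_distrib_left[of c] sum_subtractf[symmetric]
    by (intro sum.cong) (simp_all add: right_diff_distrib sum_distrib_left mult_ac)
  also have "\<dots> \<le> 0"
    by (intro sum_nonpos mult_nonneg_nonpos) (use r \<Delta> bc in \<open>auto simp: r_def\<close>)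
  finally have "r ^ k * V k \<le> V 0"
    using tel[of k] by linarith
  then have "\<theta> ^ k * (r ^ k * V k) \<le> \<theta> ^ k * V 0"
    using \<theta> by (intro mult_left_mono) auto
  then show ?thesis
    using r(2) by (simp add: mult.assoc[symmetric] power_mult_distrib[symmetric] mult.commute[of \<theta>])
qed

text \<open>Here \<open>c\<close> stands for L l(\<tau>+1) and \<open>n\<close> for \<tau>+1. The
  power form of the step bound avoids real exponents afterwards.\<close>

lemma step_size_power:
  fixes \<mu> c \<alpha>0 :: real and n :: nat
  assumes "\<mu> > 0" "c > 0" "n > 0" "\<alpha>0 = ((1 + \<mu> / c) powr (1 / real n) - 1) / \<mu>"
  shows "(1 + \<alpha>0 * \<mu>) ^ n = 1 + \<mu> / c"
proof -
  have pos: "1 + \<mu> / c > 0" using assms by (simp add: add_pos_pos)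
  have "1 + \<alpha>0 * \<mu> = (1 + \<mu> / c) powr (1 / real n)"
    using assms by simp
  then have "(1 + \<alpha>0 * \<mu>) ^ n = ((1 + \<mu> / c) powr (1 / real n)) powr real n"
    using pos by (simp add: powr_realpow)
  then show ?thesis using pos assms(3) by (simp add: powr_powr)
qed

text \<open>The geometric sum times \<alpha>\<mu> telescopes to the power minus 1, which is at most
  \<mu>/c.\<close>

lemma step_size_geometric_sum:
  fixes \<mu> c \<alpha> :: real
  assumes "\<mu> > 0" "c > 0" "\<alpha> > 0" "(1 + \<alpha> * \<mu>) ^ Suc \<tau> \<le> 1 + \<mu> / c"
  shows "c * (\<Sum>m\<le>\<tau>. (1 + \<alpha> * \<mu>) ^ m) \<le> 1 / \<alpha>"
proof -
  have "\<alpha> * \<mu> * (\<Sum>m\<le>\<tau>. (1 + \<alpha> * \<mu>) ^ m) = (1 + \<alpha> * \<mu>) ^ Suc \<tau> - 1"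
    using sum_gp_basic[of "1 + \<alpha> * \<mu>" \<tau>] by simp
  also have "\<dots> \<le> \<mu> / c" using assms(4) by simp
  finally have "\<mu> * (c * \<alpha> * (\<Sum>m\<le>\<tau>. (1 + \<alpha> * \<mu>) ^ m)) \<le> \<mu> * 1"
    using assms(2) by (simp add: field_simps)
  then have "c * \<alpha> * (\<Sum>m\<le>\<tau>. (1 + \<alpha> * \<mu>) ^ m) \<le> 1"
    using assms(1) by simp
  then show ?thesis using assms(3) by (simp add: field_simps)
qed

text \<open>With y = 1/(c/\<mu> + 1), the n-th power of the left side is 1 - y. Bernoulli bounds
  this by (1 - y/n)^n, and n-th roots are compared.\<close>

lemma step_size_rate_le:
  fixes \<mu> c \<alpha> :: real and n :: nat
  assumes "\<mu> > 0" "c > 0" "n > 0" "\<alpha> > 0" "(1 + \<alpha> * \<mu>) ^ n = 1 + \<mu> / c"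
  shows "1 / (1 + \<alpha> * \<mu>) \<le> 1 - 1 / ((c / \<mu> + 1) * real n)"
proof -
  define y where "y = 1 / (c / \<mu> + 1)"
  have y: "0 < y" "y < 1" using assms by (auto simp: y_def field_simps add_pos_pos)
  have yn: "y / real n \<le> 1"
    using y assms(3) by (simp add: field_simps)
  have "(1 / (1 + \<alpha> * \<mu>)) ^ n = 1 / (1 + \<mu> / c)"
    using assms by (simp add: power_one_over)
  also have "\<dots> = 1 - y"
    using assms(1,2) by (simp add: y_def field_simps add_pos_pos)
  also have "\<dots> = 1 + real n * (- (y / real n))" using assms(3) by simp
  also have "\<dots> \<le> (1 + - (y / real n)) ^ n"
    by (rule Bernoulli_inequality) (use yn in simp)
  finally have "(1 / (1 + \<alpha> * \<mu>)) ^ n \<le> (1 - y / real n) ^ n" by simp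
  moreover obtain m where "n = Suc m" using assms(3) gr0_conv_Suc by auto
  ultimately have "1 / (1 + \<alpha> * \<mu>) \<le> 1 - y / real n"
    using yn by (metis power_le_imp_le_base diff_ge_0_iff_ge)
  then show ?thesis by (simp add: y_def)
qed


section \<open>The PLIAG iteration\<close>

lemma ereal_sum_neq_MInf:
  fixes g :: "'b \<Rightarrow> ereal"
  assumes "\<And>i. i \<in> S \<Longrightarrow> g i \<noteq> -\<infinity>"
  shows "sum g S \<noteq> -\<infinity>"
  using assms by (induction S rule: infinite_finite_induct) auto

text \<open>\<open>L\<close> enters as an upper bound of the weights, and the step size restriction
  is left out: the one-step estimates hold for every positive \<alpha>.\<close>

locale pliag_iteration =
  fixes Q :: "'a::euclidean_space set"
    and N \<tau> :: nat
    and f :: "nat \<Rightarrow> 'a \<Rightarrow> ereal"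
    and h w \<Phi> :: "'a \<Rightarrow> ereal"
    and Ls l :: "nat \<Rightarrow> real"
    and \<mu> \<alpha> L :: real
    and J :: "nat \<Rightarrow> nat set"
    and d :: "nat \<Rightarrow> nat \<Rightarrow> nat"
    and x :: "nat \<Rightarrow> 'a"
  assumes h: "proper_lsc_convex h"
    and \<Phi>: "\<Phi> = Phi N f h"
    and X: "minimizers Q \<Phi> \<noteq> {}"
    and w: "legendre w" "Q = closure (edom w)"
    and B1: "assm_B1 N f w Ls"
    and B2: "assm_B2 h w"
    and B3: "assm_B3 Q \<Phi> w \<mu>"
    and B4: "assm_B4 w \<tau> l"
    and iter: "pliag Q N f h w \<tau> (\<lambda>k. \<alpha>) J d x"
    and L: "\<And>k. (\<Sum>j\<in>J k. Ls j) \<le> L"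
begin

abbreviation "domw \<equiv> edom w"
abbreviation "intw \<equiv> interior (edom w)"
abbreviation "wr y \<equiv> real_of_ereal (w y)"
abbreviation "fr n y \<equiv> real_of_ereal (f n y)"
abbreviation "hr y \<equiv> real_of_ereal (h y)"
text \<open>Minimizers outside the domain of \<open>w\<close> are at infinite Bregman distance from
  interior points, so this set determines the infimum.\<close>

abbreviation "Xw \<equiv> minimizers Q \<Phi> \<inter> edom w"

text \<open>These real counterparts allow ordinary arithmetic. As \<open>real_of_ereal\<close> sends
  infinities to 0, they are trusted only where the extended values are shown finite.\<close>

definition "D y z = wr y - wr z - grad w z \<bullet> (y - z)"
definition "phi y = (\<Sum>n\<in>{1..N}. fr n y) + hr y"
definition "phi_opt = real_of_ereal (opt_value Q \<Phi>)"
definition "dist_opt y = real_of_ereal (breg_dist_to w (minimizers Q \<Phi>) y)"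
definition "gam y = phi y - phi_opt + dist_opt y / \<alpha>"

section \<open>Finiteness, convexity and gradients of the data\<close>

lemma proper: "eproper w" "eproper h" "n \<in> {1..N} \<Longrightarrow> eproper (f n)"
  using w(1) h B1 by (auto simp: legendre_def proper_lsc_convex_def assm_B1_def)

lemma domw_subset: "domw \<subseteq> Q" "n \<in> {1..N} \<Longrightarrow> domw \<subseteq> edom (f n)"
  using w(2) B1 by (auto simp: closure_subset[THEN subsetD] assm_B1_def)

lemma intw_subset: "y \<in> intw \<Longrightarrow> y \<in> domw"
  using interior_subset by blast

lemma alpha_pos: "\<alpha> > 0" and mu_pos: "\<mu> > 0"
  using iter B3 by (auto simp: pliag_def assm_B3_def)

lemma J: "J k \<noteq> {}" "J k \<subseteq> {1..N}" "finite (J k)"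
proof -
  show "J k \<noteq> {}" and *: "J k \<subseteq> {1..N}"
    using iter by (auto simp: pliag_def)
  show "finite (J k)" using finite_subset[OF *] by simp
qed

lemma Ls_pos: "n \<in> {1..N} \<Longrightarrow> Ls n > 0"
  using B1 by (auto simp: assm_B1_def)

lemma L_pos: "L > 0"
proof -
  have "(\<Sum>j\<in>J 0. Ls j) > 0"
    using J[of 0] Ls_pos by (intro sum_pos) auto
  then show ?thesis using L[of 0] by simp
qed

lemma ereal_values:
  "y \<in> domw \<Longrightarrow> w y = ereal (wr y)"
  "y \<in> edom h \<Longrightarrow> h y = ereal (hr y)"
  "y \<in> domw \<Longrightarrow> n \<in> {1..N} \<Longrightarrow> f n y = ereal (fr n y)"
proof -
  show "y \<in> domw \<Longrightarrow> w y = ereal (wr y)"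
    by (rule eproper_edom[OF proper(1)])
  show "y \<in> edom h \<Longrightarrow> h y = ereal (hr y)"
    by (rule eproper_edom[OF proper(2)])
  show "y \<in> domw \<Longrightarrow> n \<in> {1..N} \<Longrightarrow> f n y = ereal (fr n y)"
    using domw_subset(2) by (intro eproper_edom proper(3)) auto
qed

lemma convex:
  "convex_on domw wr" "convex_on (edom h) hr" "n \<in> {1..N} \<Longrightarrow> convex_on (edom (f n)) (fr n)"
  using w(1) h B1
  by (auto simp: legendre_def proper_lsc_convex_def assm_B1_def intro!: econvex_imp_convex_on)

lemma gderiv:
  "y \<in> intw \<Longrightarrow> GDERIV wr y :> grad w y"
  "y \<in> intw \<Longrightarrow> n \<in> {1..N} \<Longrightarrow> GDERIV (fr n) y :> grad (f n) y"
  using w(1) B1 by (auto simp: legendre_def assm_B1_def intro!: GDERIV_grad)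

lemma bregman_eq: "z \<in> domw \<Longrightarrow> y \<in> intw \<Longrightarrow> bregman w z y = ereal (D z y)"
  unfolding bregman_def D_def
  by (subst ereal_values(1), assumption, subst ereal_values(1)[OF intw_subset], assumption) simp

lemma bregman_infty: "z \<notin> domw \<Longrightarrow> y \<in> intw \<Longrightarrow> bregman w z y = \<infinity>"
  unfolding bregman_def
  by (subst ereal_values(1)[OF intw_subset, of y], assumption) (simp add: edom_def)

lemma D_nonneg: "z \<in> domw \<Longrightarrow> y \<in> intw \<Longrightarrow> D z y \<ge> 0"
  using convex_on_gradient_le[OF convex(1) intw_subset _ gderiv(1), of y z] by (simp add: D_def)

lemma three_point:
  "(grad w p - grad w y) \<bullet> (z - p) = D z y - D z p - D p y"
  by (simp add: D_def algebra_simps)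

lemma sum_f_eq: "y \<in> domw \<Longrightarrow> S \<subseteq> {1..N} \<Longrightarrow> (\<Sum>n\<in>S. f n y) = ereal (\<Sum>n\<in>S. fr n y)"
  unfolding sum_ereal[symmetric] by (intro sum.cong refl ereal_values(3)) auto

lemma sum_f_neq_MInf: "S \<subseteq> {1..N} \<Longrightarrow> (\<Sum>n\<in>S. f n y) \<noteq> -\<infinity>"
  using proper(3) by (intro ereal_sum_neq_MInf) (auto simp: eproper_def)

section \<open>Optimal value and distance to the solution set\<close>

lemma Phi_eq: "y \<in> domw \<Longrightarrow> y \<in> edom h \<Longrightarrow> \<Phi> y = ereal (phi y)"
  unfolding \<Phi> Phi_def phi_def
  by (subst ereal_values(2), assumption, subst sum_f_eq, assumption) simp_all

lemma Phi_infty: "y \<notin> edom h \<Longrightarrow> \<Phi> y = \<infinity>"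
  using sum_f_neq_MInf[of "{1..N}" y] by (auto simp: \<Phi> Phi_def edom_def)

lemma Phi_neq_MInf: "\<Phi> y \<noteq> -\<infinity>"
  using sum_f_neq_MInf[of "{1..N}" y] proper(2)
  by (auto simp: \<Phi> Phi_def eproper_def ereal_plus_eq_MInfty)

lemma interior_dom_point: obtains q where "q \<in> intw" "q \<in> edom h"
  using B2 by (auto simp: assm_B2_def)

text \<open>The optimal value is attained, hence not minus infinity, and it is bounded above by the
  finite value at a point of dom h in the interior of dom w.\<close>

lemma opt_value_eq: "opt_value Q \<Phi> = ereal phi_opt"
  and minimizer_Phi: "z \<in> minimizers Q \<Phi> \<Longrightarrow> \<Phi> z = ereal phi_opt"
proof -
  have *: "opt_value Q \<Phi> = \<Phi> z" if "z \<in> minimizers Q \<Phi>" for z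
    using that unfolding opt_value_def minimizers_def is_arg_min_def
    by (intro antisym INF_lower INF_greatest) (auto simp: not_less)
  obtain z where z: "z \<in> minimizers Q \<Phi>" using X by blast
  obtain q where q: "q \<in> intw" "q \<in> edom h" by (rule interior_dom_point)
  then have "\<Phi> q = ereal (phi q)" "q \<in> Q"
    using Phi_eq intw_subset domw_subset by auto
  then have "opt_value Q \<Phi> \<le> ereal (phi q)"
    unfolding opt_value_def by (metis INF_lower)
  then show opt: "opt_value Q \<Phi> = ereal phi_opt"
    using *[OF z] Phi_neq_MInf[of z] unfolding phi_opt_def by (cases "\<Phi> z") auto
  show "\<Phi> z = ereal phi_opt" if "z \<in> minimizers Q \<Phi>" for z
    using *[OF that] opt by simp
qed

lemma Xw_edom_h: "z \<in> Xw \<Longrightarrow> z \<in> edom h"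
  using Phi_infty minimizer_Phi by fastforce

lemma Xw_phi: "z \<in> Xw \<Longrightarrow> phi z = phi_opt"
  using Phi_eq[of z] minimizer_Phi[of z] Xw_edom_h by auto

lemma phi_opt_le: "y \<in> domw \<Longrightarrow> y \<in> edom h \<Longrightarrow> phi_opt \<le> phi y"
  using Phi_eq[of y] opt_value_eq domw_subset unfolding opt_value_def
  by (metis INF_lower ereal_less_eq(3) subsetD)

text \<open>Otherwise the distance would be infinite everywhere in the interior, and growth would
  force an infinite gap at a point where \<Phi> is finite.\<close>

lemma Xw_nonempty: "Xw \<noteq> {}"
proof
  assume e: "Xw = {}"
  obtain q where q: "q \<in> intw" "q \<in> edom h" by (rule interior_dom_point)
  have "breg_dist_to w (minimizers Q \<Phi>) q = \<infinity>"
    unfolding breg_dist_to_def using e bregman_infty q(1)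
    by (intro top_ereal_def[THEN sym, THEN trans[rotated]] INF_eqI) (auto simp: top_ereal_def)
  then have "\<Phi> q - opt_value Q \<Phi> \<ge> \<infinity>"
    using B3 q(1) mu_pos unfolding assm_B3_def by fastforce
  then show False
    using Phi_eq[OF intw_subset[OF q(1)] q(2)] opt_value_eq by simp
qed

text \<open>The last two facts express the infimum property, so later arguments never select a
  nearest minimizer.\<close>

lemma breg_dist_to_eq: "y \<in> intw \<Longrightarrow> breg_dist_to w (minimizers Q \<Phi>) y = ereal (dist_opt y)"
  and dist_opt_nonneg: "y \<in> intw \<Longrightarrow> 0 \<le> dist_opt y"
  and dist_opt_le: "y \<in> intw \<Longrightarrow> z \<in> Xw \<Longrightarrow> dist_opt y \<le> D z y"
  and dist_opt_ge: "y \<in> intw \<Longrightarrow> (\<And>z. z \<in> Xw \<Longrightarrow> m \<le> D z y) \<Longrightarrow> m \<le> dist_opt y"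
proof -
  let ?d = "breg_dist_to w (minimizers Q \<Phi>) y"
  assume y: "y \<in> intw"
  have lower: "ereal c \<le> ?d" if "\<And>z. z \<in> Xw \<Longrightarrow> c \<le> D z y" for c
    unfolding breg_dist_to_def
  proof (rule INF_greatest)
    fix z assume "z \<in> minimizers Q \<Phi>"
    then show "ereal c \<le> bregman w z y"
      using that bregman_eq[OF _ y] bregman_infty[OF _ y] by (cases "z \<in> domw") auto
  qed
  have upper: "?d \<le> ereal (D z y)" if "z \<in> Xw" for z
    unfolding breg_dist_to_def using that bregman_eq[OF _ y] by (auto intro: INF_lower2)
  have "?d \<noteq> \<infinity>"
    using upper Xw_nonempty by fastforce
  moreover have "0 \<le> ?d"
    using lower[of 0] D_nonneg y by (auto simp: zero_ereal_def)
  ultimately show eq: "?d = ereal (dist_opt y)"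
    unfolding dist_opt_def by (cases ?d) auto
  show "0 \<le> dist_opt y" using lower[of 0] D_nonneg y eq by auto
  show "dist_opt y \<le> D z y" if "z \<in> Xw" using upper[OF that] eq by simp
  show "m \<le> dist_opt y" if "\<And>z. z \<in> Xw \<Longrightarrow> m \<le> D z y" using lower[OF that] eq by simp
qed

lemma growth: "y \<in> intw \<Longrightarrow> y \<in> edom h \<Longrightarrow> \<mu> * dist_opt y \<le> phi y - phi_opt"
  using B3 Phi_eq[OF intw_subset, of y] opt_value_eq breg_dist_to_eq[of y]
  unfolding assm_B3_def by fastforce

lemma Gam_eq: "y \<in> intw \<Longrightarrow> y \<in> edom h \<Longrightarrow> Gam Q \<Phi> w \<alpha> y = ereal (gam y)"
  unfolding Gam_def gam_def
  by (simp add: Phi_eq[OF intw_subset] opt_value_eq breg_dist_to_eq)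

lemma Gam_infty: "y \<in> intw \<Longrightarrow> y \<notin> edom h \<Longrightarrow> Gam Q \<Phi> w \<alpha> y = \<infinity>"
  unfolding Gam_def by (simp add: Phi_infty opt_value_eq breg_dist_to_eq)

section \<open>The subproblem and its minimizer\<close>

text \<open>The objective of step \<open>k\<close>, multiplied by \<open>\<alpha>\<close> and with \<open>w\<close> and constants split off.\<close>

definition "step_fun k y = \<alpha> * (hr y + (\<Sum>i\<in>{1..N} - J k. fr i y)
   + (\<Sum>j\<in>J k. grad (f j) (x (k - d k j))) \<bullet> y) - grad w (x k) \<bullet> y"

lemma convex_on_step_fun: "convex_on (domw \<inter> edom h) (step_fun k)"
proof -
  have c: "convex (domw \<inter> edom h)"
    using convex(1,2) by (auto simp: convex_on_def intro: convex_Int)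
  have lin: "convex_on (domw \<inter> edom h) (\<lambda>y. v \<bullet> y)" for v :: 'a
    by (rule convex_onI) (simp_all add: c inner_add_right)
  have nlin: "convex_on (domw \<inter> edom h) (\<lambda>y. - (v \<bullet> y))" for v :: 'a
    using lin[of "- v"] by simp
  have hc: "convex_on (domw \<inter> edom h) hr"
    by (rule convex_on_subset[OF convex(2) _ c]) simp
  have "convex_on (domw \<inter> edom h) (fr i)" if "i \<in> {1..N} - J k" for i
    using convex(3)[of i] domw_subset(2)[of i] that c convex_on_subset[of _ "fr i" "domw \<inter> edom h"] by auto
  then have "convex_on (domw \<inter> edom h) (\<lambda>y. \<Sum>i\<in>S. fr i y)" if "S \<subseteq> {1..N} - J k" for S
    using that finite_subset[OF that]
  proof (induction S rule: infinite_finite_induct)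
    case (insert i S)
    then show ?case by (simp add: convex_on_add)
  qed (auto simp: c convex_on_const)
  then have "convex_on (domw \<inter> edom h) (\<lambda>y. \<Sum>i\<in>{1..N} - J k. fr i y)" by simp
  then have "convex_on (domw \<inter> edom h) (\<lambda>y. \<alpha> * (hr y + (\<Sum>i\<in>{1..N} - J k. fr i y)
      + (\<Sum>j\<in>J k. grad (f j) (x (k - d k j))) \<bullet> y) + - (grad w (x k) \<bullet> y))"
    using alpha_pos hc lin nlin by (intro convex_on_add convex_on_cmul) auto
  then show ?thesis unfolding step_fun_def by simp
qed

lemma objective_eq:
  assumes "x k \<in> intw" "y \<in> domw" "y \<in> edom h"
  shows "pliag_objective N f h w (\<lambda>k. \<alpha>) J d x k y
     = ereal ((step_fun k y + wr y + grad w (x k) \<bullet> x k - wr (x k)) / \<alpha>)"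
proof -
  have "pliag_objective N f h w (\<lambda>k. \<alpha>) J d x k y
     = ereal (hr y + (\<Sum>i\<in>{1..N} - J k. fr i y)
       + (\<Sum>j\<in>J k. grad (f j) (x (k - d k j))) \<bullet> y + 1 / \<alpha> * D y (x k))"
    unfolding pliag_objective_def
    by (subst ereal_values(2)[OF assms(3)], subst sum_f_eq[OF assms(2)],
        simp_all add: bregman_eq[OF assms(2,1)])
  also have "hr y + (\<Sum>i\<in>{1..N} - J k. fr i y)
       + (\<Sum>j\<in>J k. grad (f j) (x (k - d k j))) \<bullet> y + 1 / \<alpha> * D y (x k)
     = (step_fun k y + wr y + grad w (x k) \<bullet> x k - wr (x k)) / \<alpha>"
    using alpha_pos by (simp add: step_fun_def D_def field_simps inner_diff_right)
  finally show ?thesis .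
qed

lemma iterate_le:
  assumes "y \<in> domw"
  shows "pliag_objective N f h w (\<lambda>k. \<alpha>) J d x k (x (Suc k))
    \<le> pliag_objective N f h w (\<lambda>k. \<alpha>) J d x k y"
proof -
  have "is_arg_min (pliag_objective N f h w (\<lambda>k. \<alpha>) J d x k) (\<lambda>y. y \<in> Q) (x (Suc k))"
    using iter unfolding pliag_def by blast
  then show ?thesis
    using assms domw_subset(1) unfolding is_arg_min_def by (meson not_less subsetD)
qed

text \<open>The minimal value is finite, by comparison with \<open>q\<close>. No summand is minus
  infinity, so an infinite \<open>w\<close> or \<open>h\<close> at the new iterate would make it
  infinite.\<close>

lemma step_dom:
  assumes k: "x k \<in> intw"
  shows "x (Suc k) \<in> domw" "x (Suc k) \<in> edom h"
proof -
  let ?obj = "pliag_objective N f h w (\<lambda>k. \<alpha>) J d x k"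
  let ?p = "x (Suc k)"
  obtain q where q: "q \<in> intw" "q \<in> edom h" by (rule interior_dom_point)
  have "?obj ?p \<le> ?obj q"
    using q(1) intw_subset
    by (intro iterate_le) auto
  also have "\<dots> < \<infinity>"
    using objective_eq[OF k intw_subset[OF q(1)] q(2)] by simp
  finally have fin: "?obj ?p \<noteq> \<infinity>" by simp
  have hp: "h ?p \<noteq> -\<infinity>" using proper(2) by (simp add: eproper_def)
  have fp: "(\<Sum>i\<in>{1..N} - J k. f i ?p) \<noteq> -\<infinity>" by (rule sum_f_neq_MInf) auto
  have bp: "bregman w ?p (x k) \<noteq> -\<infinity>"
    using bregman_eq[OF _ k] bregman_infty[OF _ k] by (cases "?p \<in> domw") auto
  show "?p \<in> domw"
  proof (rule ccontr)
    assume "?p \<notin> domw"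
    from bregman_infty[OF this k] fin hp fp alpha_pos show False
      by (simp add: pliag_objective_def)
  qed
  show "?p \<in> edom h"
  proof (rule ccontr)
    assume "?p \<notin> edom h"
    then have "h ?p = \<infinity>" by (simp add: edom_def)
    with fin hp fp bp alpha_pos show False
      by (simp add: pliag_objective_def)
  qed
qed

lemma step_min:
  assumes k: "x k \<in> intw" and y: "y \<in> domw" "y \<in> edom h"
  shows "step_fun k (x (Suc k)) + wr (x (Suc k)) \<le> step_fun k y + wr y"
proof -
  have "pliag_objective N f h w (\<lambda>k. \<alpha>) J d x k (x (Suc k))
      \<le> pliag_objective N f h w (\<lambda>k. \<alpha>) J d x k y"
    by (rule iterate_le[OF y(1)])
  then show ?thesis
    using objective_eq[OF k step_dom[OF k]] objective_eq[OF k y] alpha_pos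
    by (simp add: divide_le_cancel)
qed

text \<open>Induction is needed because the Bregman term of step k is meaningful only once
  \<open>x k\<close> is interior; \<open>prox_point_in_interior\<close> then carries this to the
  next iterate.\<close>

lemma iterates_interior: "x k \<in> intw"
proof (induction k)
  case 0
  then show ?case using iter by (simp add: pliag_def)
next
  case (Suc k)
  obtain q where q: "q \<in> intw" "q \<in> edom h" by (rule interior_dom_point)
  have blow: "filterlim (\<lambda>k. norm (grad w (y k))) at_top sequentially"
    if "\<And>k. y k \<in> intw" "b \<in> frontier domw" "y \<longlonglongrightarrow> b" for y :: "nat \<Rightarrow> 'a" and b
    using w(1) that unfolding legendre_def by blast
  show ?case
  proof (rule prox_point_in_interior[OF convex(1) gderiv(1) _ convex_on_step_fun[of k] _ _ q(1)])
    show "filterlim (\<lambda>k. norm (grad w (y k))) at_top sequentially"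
      if "\<And>k. y k \<in> intw" "b \<in> frontier domw" "y \<longlonglongrightarrow> b" for y :: "nat \<Rightarrow> 'a" and b
      using that by (rule blow)
  qed (use q step_dom[OF Suc] step_min[OF Suc] intw_subset in auto)
qed

lemma iterates_edom_h: "x (Suc k) \<in> edom h"
  using step_dom(2)[OF iterates_interior] .

section \<open>One-step estimates\<close>

lemma prox_inequality:
  assumes z: "z \<in> domw" "z \<in> edom h"
  shows "step_fun k (x (Suc k)) + grad w (x k) \<bullet> x (Suc k)
    \<le> step_fun k z + grad w (x k) \<bullet> z + D z (x k) - D z (x (Suc k)) - D (x (Suc k)) (x k)"
proof -
  have "step_fun k (x (Suc k)) - step_fun k z \<le> grad w (x (Suc k)) \<bullet> (z - x (Suc k))"
    by (rule prox_variational_inequality[OF convex(1) gderiv(1)[OF iterates_interior] convex_on_step_fun])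
      (use z step_dom[OF iterates_interior] step_min[OF iterates_interior] in auto)
  then show ?thesis
    using three_point[of "x (Suc k)" "x k" z] by (simp add: algebra_simps)
qed

text \<open>Convexity of L_n w - f_n compares \<open>p\<close> with the linearization at
  \<open>y\<close>, and convexity of f_n compares that linearization with f_n(z). Only the second
  uses \<open>z\<close>, which may therefore lie on the boundary.\<close>

lemma component_descent:
  assumes n: "n \<in> {1..N}" and y: "y \<in> intw" and p: "p \<in> intw" and z: "z \<in> domw"
  shows "fr n p \<le> fr n z + grad (f n) y \<bullet> (p - z) + Ls n * D p y"
proof -
  have cvx: "convex_on intw (\<lambda>y. Ls n * wr y - fr n y)"
    using B1 n by (simp add: assm_B1_def)
  have "GDERIV (\<lambda>y. Ls n * wr y - fr n y) y :> Ls n *\<^sub>R grad w y - grad (f n) y"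
    using gderiv(1)[OF y] gderiv(2)[OF y n] unfolding gderiv_def
    by (auto intro!: derivative_eq_intros simp: inner_diff_right)
  from convex_on_gradient_le[OF cvx y p this]
  have "fr n p \<le> fr n y + grad (f n) y \<bullet> (p - y) + Ls n * D p y"
    by (simp add: D_def algebra_simps)
  moreover have "fr n y + grad (f n) y \<bullet> (z - y) \<le> fr n z"
    using domw_subset(2)[OF n] intw_subset[OF y] z
    by (intro convex_on_gradient_le[OF convex(3)[OF n] _ _ gderiv(2)[OF y n]]) auto
  ultimately show ?thesis by (simp add: algebra_simps)
qed

lemma l_ge_1: "1 \<le> n \<Longrightarrow> n \<le> \<tau> + 1 \<Longrightarrow> 1 \<le> l n \<and> l n \<le> l (\<tau> + 1)"
proof (cases "\<tau> = 0")
  case False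
  assume n: "1 \<le> n" "n \<le> \<tau> + 1"
  have "mono_on {1..} l" "l 1 = 1" using B4 False by (auto simp: assm_B4_def)
  then show ?thesis using n monotone_onD[of "{1..}" "(\<le>)" "(\<le>)" l] by fastforce
qed (use B4 in \<open>auto simp: assm_B4_def dest: le_antisym\<close>)

abbreviation "step_dist k \<equiv> D (x (Suc k)) (x k)"

lemma step_dist_nonneg: "0 \<le> step_dist k"
  by (intro D_nonneg iterates_interior intw_subset)

lemma delayed_distance:
  assumes j: "j \<le> k" "k \<le> j + \<tau>"
  shows "D (x (Suc k)) (x j) \<le> l (\<tau> + 1) * (\<Sum>i\<in>{j..k}. step_dist i)"
proof -
  have nonneg: "0 \<le> (\<Sum>i\<in>{j..k}. step_dist i)"
    by (intro sum_nonneg step_dist_nonneg)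
  have "D (x (Suc k)) (x j) \<le> l (Suc k - j) * (\<Sum>i\<in>{j..k}. step_dist i)"
  proof (cases "j = k")
    case True
    \<comment> \<open>B4 excludes adjacent indices; there l(1) = 1 gives equality.\<close>
    then show ?thesis using B4 by (simp add: assm_B4_def)
  next
    case False
    \<comment> \<open>B4 numbers its sequences from 1, whence the index shift.\<close>
    define v where "v i = x (i - 1)" for i
    have bv: "bregman w (v a) (v b) = ereal (D (v a) (v b))" for a b
      unfolding v_def by (intro bregman_eq iterates_interior intw_subset)
    have "bregman w (v (Suc (Suc k))) (v (Suc j))
        \<le> ereal (l (Suc (Suc k) - Suc j))
          * (\<Sum>i\<in>{Suc j..Suc (Suc k) - 1}. bregman w (v (i + 1)) (v i))"
    proof -
      have "\<tau> > 0" using False j by simp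
      then have *: "bregman w (v k) (v j) \<le> ereal (l (k - j)) * (\<Sum>i\<in>{j..k - 1}. bregman w (v (i + 1)) (v i))"
        if "\<forall>i\<in>{1..k}. v i \<in> intw" "1 \<le> j" "j + 1 < k" for k j
        using B4 that unfolding assm_B4_def by blast
      show ?thesis
        by (rule *) (use False j iterates_interior in \<open>auto simp: v_def\<close>)
    qed
    then show ?thesis
      unfolding diff_Suc_1 sum.shift_bounds_cl_Suc_ivl bv by (simp add: v_def)
  qed
  also have "\<dots> \<le> l (\<tau> + 1) * (\<Sum>i\<in>{j..k}. step_dist i)"
    using l_ge_1[of "Suc k - j"] j by (intro mult_right_mono nonneg) auto
  finally show ?thesis .
qed

text \<open>Each delayed window is enlarged to the common window reaching back \<tau> steps, which
  is legitimate as step distances are nonnegative. What remains is the weight sum, at most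
  \<open>L\<close>.\<close>

lemma delay_error:
  "(\<Sum>j\<in>J k. Ls j * D (x (Suc k)) (x (k - d k j)))
    \<le> L * l (\<tau> + 1) * (\<Sum>i\<in>{k - \<tau>..k}. step_dist i)"
proof -
  let ?S = "\<Sum>i\<in>{k - \<tau>..k}. step_dist i"
  have l: "l (\<tau> + 1) \<ge> 1" using l_ge_1[of "\<tau> + 1"] by simp
  have "(\<Sum>j\<in>J k. Ls j * D (x (Suc k)) (x (k - d k j))) \<le> (\<Sum>j\<in>J k. Ls j * (l (\<tau> + 1) * ?S))"
  proof (rule sum_mono)
    fix j assume "j \<in> J k"
    then have j: "j \<in> {1..N}" using J(2)[of k] by auto
    then have d: "d k j \<le> \<tau>" using iter by (simp add: pliag_def)
    have "D (x (Suc k)) (x (k - d k j)) \<le> l (\<tau> + 1) * (\<Sum>i\<in>{k - d k j..k}. step_dist i)"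
      using d by (intro delayed_distance) auto
    also have "\<dots> \<le> l (\<tau> + 1) * ?S"
      using d l by (intro mult_left_mono sum_mono2 step_dist_nonneg) auto
    finally show "Ls j * D (x (Suc k)) (x (k - d k j)) \<le> Ls j * (l (\<tau> + 1) * ?S)"
      using Ls_pos[OF j] by (intro mult_left_mono) auto
  qed
  also have "\<dots> = (\<Sum>j\<in>J k. Ls j) * (l (\<tau> + 1) * ?S)"
    by (simp add: sum_distrib_right)
  also have "\<dots> \<le> L * (l (\<tau> + 1) * ?S)"
    using l by (intro mult_right_mono L mult_nonneg_nonneg sum_nonneg step_dist_nonneg) auto
  finally show ?thesis by (simp add: mult.assoc)
qed

text \<open>The prox inequality handles h and the components outside \<open>J k\<close>,
  \<open>component_descent\<close> those in \<open>J k\<close>. Both use the same delayed gradients,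
  so the linear terms cancel.\<close>

lemma progress:
  assumes z: "z \<in> Xw"
  shows "phi (x (Suc k)) - phi_opt + D z (x (Suc k)) / \<alpha>
    \<le> D z (x k) / \<alpha> - step_dist k / \<alpha> + L * l (\<tau> + 1) * (\<Sum>i\<in>{k - \<tau>..k}. step_dist i)"
proof -
  let ?p = "x (Suc k)"
  let ?g = "\<lambda>j. grad (f j) (x (k - d k j))"
  let ?I = "{1..N} - J k"
  have z': "z \<in> domw" "z \<in> edom h" using z Xw_edom_h by auto
  have split: "phi y = hr y + (\<Sum>i\<in>?I. fr i y) + (\<Sum>j\<in>J k. fr j y)" for y
    unfolding phi_def using sum.subset_diff[OF J(2), of "\<lambda>n. fr n y"] by simp
  have "\<alpha> * (hr ?p + (\<Sum>i\<in>?I. fr i ?p) + (\<Sum>j\<in>J k. ?g j) \<bullet> ?p)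
      \<le> \<alpha> * (hr z + (\<Sum>i\<in>?I. fr i z) + (\<Sum>j\<in>J k. ?g j) \<bullet> z) + (D z (x k) - D z ?p - step_dist k)"
    using prox_inequality[OF z', of k] by (simp add: step_fun_def)
  then have prox: "hr ?p + (\<Sum>i\<in>?I. fr i ?p) + (\<Sum>j\<in>J k. ?g j) \<bullet> ?p
      \<le> hr z + (\<Sum>i\<in>?I. fr i z) + (\<Sum>j\<in>J k. ?g j) \<bullet> z + (D z (x k) - D z ?p - step_dist k) / \<alpha>"
    using alpha_pos by (simp add: field_simps)
  have "(\<Sum>j\<in>J k. fr j ?p)
      \<le> (\<Sum>j\<in>J k. fr j z + ?g j \<bullet> (?p - z) + Ls j * D ?p (x (k - d k j)))"
    using J(2)[of k] z' by (intro sum_mono component_descent iterates_interior) auto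
  also have "\<dots> = (\<Sum>j\<in>J k. fr j z) + (\<Sum>j\<in>J k. ?g j) \<bullet> (?p - z)
      + (\<Sum>j\<in>J k. Ls j * D ?p (x (k - d k j)))"
    by (simp add: sum.distrib inner_sum_left)
  finally have "(\<Sum>j\<in>J k. fr j ?p) \<le> (\<Sum>j\<in>J k. fr j z) + (\<Sum>j\<in>J k. ?g j) \<bullet> (?p - z)
      + L * l (\<tau> + 1) * (\<Sum>i\<in>{k - \<tau>..k}. step_dist i)"
    using delay_error[of k] by linarith
  with prox Xw_phi[OF z] show ?thesis
    unfolding split by (simp add: inner_diff_right diff_divide_distrib)
qed

text \<open>On the left D(z, x(k+1)) is first lowered to \<open>dist_opt\<close>. The left side is
  then free of z, and the infimum over z can be taken on the right.\<close>

lemma gam_progress: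
  "gam (x (Suc k)) \<le> dist_opt (x k) / \<alpha> - step_dist k / \<alpha>
    + L * l (\<tau> + 1) * (\<Sum>i\<in>{k - \<tau>..k}. step_dist i)" (is "_ \<le> _ + ?R")
proof -
  have "\<alpha> * (gam (x (Suc k)) + step_dist k / \<alpha> - ?R) \<le> dist_opt (x k)"
  proof (rule dist_opt_ge[OF iterates_interior])
    fix z assume z: "z \<in> Xw"
    have "dist_opt (x (Suc k)) / \<alpha> \<le> D z (x (Suc k)) / \<alpha>"
      using dist_opt_le[OF iterates_interior z] alpha_pos by (simp add: divide_right_mono)
    with progress[OF z, of k] have "gam (x (Suc k)) + step_dist k / \<alpha> - ?R \<le> D z (x k) / \<alpha>"
      by (simp add: gam_def)
    then show "\<alpha> * (gam (x (Suc k)) + step_dist k / \<alpha> - ?R) \<le> D z (x k)"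
      using alpha_pos by (simp add: pos_le_divide_eq mult.commute)
  qed
  then have "gam (x (Suc k)) + step_dist k / \<alpha> - ?R \<le> dist_opt (x k) / \<alpha>"
    using alpha_pos by (simp add: pos_le_divide_eq mult.commute)
  then show ?thesis by simp
qed

section \<open>Contraction of the Lyapunov function\<close>

lemma dist_opt_le_gam:
  assumes "y \<in> intw" "y \<in> edom h"
  shows "dist_opt y \<le> \<alpha> * (1 / (1 + \<alpha> * \<mu>) * gam y)"
proof -
  \<comment> \<open>Growth absorbs the \<alpha>\<mu> share into the objective gap; the remaining
    copy is the distance term of \<open>gam\<close>.\<close>
  have "dist_opt y * (1 + \<alpha> * \<mu>) = \<alpha> * (\<mu> * dist_opt y) + dist_opt y"
    by (simp add: algebra_simps)
  also have "\<dots> \<le> \<alpha> * (phi y - phi_opt) + dist_opt y"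
    using growth[OF assms] alpha_pos by simp
  also have "\<dots> = \<alpha> * gam y"
    using alpha_pos by (simp add: gam_def field_simps)
  finally show ?thesis
    using alpha_pos mu_pos by (simp add: pos_le_divide_eq add_pos_pos)
qed

text \<open>Later iterates lie in dom h automatically. The starting point need not, and
  \<open>gam\<close> represents \<Gamma> only there, so this is assumed for
  \<open>x 0\<close>.\<close>

lemma gam_rate:
  assumes x0: "x 0 \<in> edom h"
    and step: "L * l (\<tau> + 1) * (\<Sum>m\<le>\<tau>. (1 + \<alpha> * \<mu>) ^ m) \<le> 1 / \<alpha>"
  shows "gam (x k) \<le> (1 / (1 + \<alpha> * \<mu>)) ^ k * gam (x 0)"
proof (rule delayed_recursion_linear_rate[where V = "\<lambda>k. gam (x k)"])
  fix k
  have "x k \<in> edom h" using x0 iterates_edom_h by (cases k) auto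
  from dist_opt_le_gam[OF iterates_interior this]
  have "dist_opt (x k) / \<alpha> \<le> 1 / (1 + \<alpha> * \<mu>) * gam (x k)"
    using alpha_pos by (simp add: pos_divide_le_eq mult.commute)
  with gam_progress[of k]
  show "gam (x (Suc k)) \<le> 1 / (1 + \<alpha> * \<mu>) * gam (x k) - (1 / \<alpha>) * step_dist k
      + L * l (\<tau> + 1) * (\<Sum>i\<in>{k - \<tau>..k}. step_dist i)" by simp
  show "0 \<le> step_dist k" by (rule step_dist_nonneg)
next
  show "0 < 1 / (1 + \<alpha> * \<mu>)" using alpha_pos mu_pos by (simp add: add_pos_pos)
  show "0 \<le> L * l (\<tau> + 1)" using L_pos l_ge_1[of "\<tau> + 1"] by simp
  show "L * l (\<tau> + 1) * (\<Sum>m\<le>\<tau>. inverse (1 / (1 + \<alpha> * \<mu>)) ^ m) \<le> 1 / \<alpha>"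
    using step by (simp add: inverse_eq_divide)
qed

lemma gam_nonneg: "y \<in> intw \<Longrightarrow> y \<in> edom h \<Longrightarrow> 0 \<le> gam y"
  using phi_opt_le[OF intw_subset, of y] dist_opt_nonneg[of y] alpha_pos by (simp add: gam_def)

end

section \<open>The rates in extended-real form\<close>

theorem theorem4p2:
  fixes Q :: "'a::euclidean_space set"
    and N \<tau> :: nat
    and f :: "nat \<Rightarrow> 'a \<Rightarrow> ereal"
    and h w \<Phi> :: "'a \<Rightarrow> ereal"
    and Ls l :: "nat \<Rightarrow> real"
    and \<mu> \<alpha> \<alpha>0 L :: real
    and J :: "nat \<Rightarrow> nat set"
    and d :: "nat \<Rightarrow> nat \<Rightarrow> nat"
    and x :: "nat \<Rightarrow> 'a"
  assumes Q: "Q \<noteq> {}" "closed Q" "convex Q" "interior Q \<noteq> {}"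
    and h: "proper_lsc_convex h"
    and \<Phi>: "\<Phi> = Phi N f h"
    and X: "minimizers Q \<Phi> \<noteq> {}" "compact (minimizers Q \<Phi>)"
    and w: "legendre w" "Q = closure (edom w)"
    and B1: "assm_B1 N f w Ls"
    and B2: "assm_B2 h w"
    and B3: "assm_B3 Q \<Phi> w \<mu>"
    and B4: "assm_B4 w \<tau> l"
    and iter: "pliag Q N f h w \<tau> (\<lambda>k. \<alpha>) J d x"
    and L: "L = Max (range (\<lambda>k. \<Sum>j\<in>J k. Ls j))"
    and \<alpha>0: "\<alpha>0 = ((1 + \<mu> / L * (1 / l (\<tau> + 1))) powr (1 / real (\<tau> + 1)) - 1) / \<mu>"
    and \<alpha>: "0 < \<alpha>" "\<alpha> \<le> \<alpha>0"
  shows "(\<forall>k. Gam Q \<Phi> w \<alpha> (x k) \<le> ereal ((1 / (1 + \<alpha> * \<mu>)) ^ k) * Gam Q \<Phi> w \<alpha> (x 0))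
    \<and> (\<forall>k. \<Phi> (x k) - opt_value Q \<Phi> \<le> ereal ((1 / (1 + \<alpha> * \<mu>)) ^ k) * Gam Q \<Phi> w \<alpha> (x 0))
    \<and> (\<forall>k. breg_dist_to w (minimizers Q \<Phi>) (x k)
          \<le> ereal \<alpha> * Gam Q \<Phi> w \<alpha> (x 0) * ereal ((1 / (1 + \<alpha> * \<mu>)) ^ (k + 1)))
    \<and> (\<alpha> = \<alpha>0 \<longrightarrow> (\<forall>k. Gam Q \<Phi> w \<alpha>0 (x k)
          \<le> ereal ((1 - 1 / ((l (\<tau> + 1) * (L / \<mu>) + 1) * real (\<tau> + 1))) ^ k)
             * Gam Q \<Phi> w \<alpha>0 (x 0)))"
proof -
  have "pliag_iteration Q N \<tau> f h w \<Phi> Ls l \<mu> \<alpha> L J d x"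
  proof
    fix k
    have J: "J k \<in> Pow {1..N}" for k
      using iter by (auto simp: pliag_def)
    \<comment> \<open>There are finitely many subsets of {1..N}, so the weight sums take finitely
      many values and \<open>Max\<close> is a genuine maximum.\<close>
    have "range (\<lambda>k. \<Sum>j\<in>J k. Ls j) \<subseteq> (\<lambda>S. \<Sum>j\<in>S. Ls j) ` Pow {1..N}"
      using J by blast
    then have "finite (range (\<lambda>k. \<Sum>j\<in>J k. Ls j))"
      by (rule finite_subset) simp
    then show "(\<Sum>j\<in>J k. Ls j) \<le> L"
      unfolding L by (intro Max_ge) auto
  qed fact+
  then interpret pliag_iteration Q N \<tau> f h w \<Phi> Ls l \<mu> \<alpha> L J d x .
  let ?\<theta> = "1 / (1 + \<alpha> * \<mu>)"
  let ?c = "L * l (\<tau> + 1)"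
  have c: "?c > 0" using L_pos l_ge_1[of "\<tau> + 1"] by simp
  have \<theta>: "?\<theta> > 0" using alpha_pos mu_pos by (simp add: add_pos_pos)
  have \<alpha>0_pow: "(1 + \<alpha>0 * \<mu>) ^ (\<tau> + 1) = 1 + \<mu> / ?c"
    by (rule step_size_power[OF mu_pos c]) (simp_all add: \<alpha>0)
  have "(1 + \<alpha> * \<mu>) ^ Suc \<tau> \<le> (1 + \<alpha>0 * \<mu>) ^ (\<tau> + 1)"
    unfolding Suc_eq_plus1 using alpha_pos mu_pos \<alpha>(2)
    by (intro power_mono add_left_mono mult_right_mono) auto
  then have step: "?c * (\<Sum>m\<le>\<tau>. (1 + \<alpha> * \<mu>) ^ m) \<le> 1 / \<alpha>"
    unfolding \<alpha>0_pow by (rule step_size_geometric_sum[OF mu_pos c alpha_pos])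
  have rate_le: "?\<theta> \<le> 1 - 1 / ((l (\<tau> + 1) * (L / \<mu>) + 1) * real (\<tau> + 1))" if "\<alpha> = \<alpha>0"
    using step_size_rate_le[OF mu_pos c _ alpha_pos, of "\<tau> + 1"] \<alpha>0_pow that
    by (simp add: mult.commute)
  show ?thesis
  proof (cases "x 0 \<in> edom h")
    \<comment> \<open>With \<Gamma>(x 0) infinite, every right-hand side is infinite. Positivity of
      the factors matters because 0 times infinity is 0 for extended reals.\<close>
    case False
    have inf: "Gam Q \<Phi> w \<alpha> (x 0) = \<infinity>"
      by (rule Gam_infty[OF iterates_interior False])
    have pos: "0 < 1 - 1 / ((l (\<tau> + 1) * (L / \<mu>) + 1) * real (\<tau> + 1))" if "\<alpha> = \<alpha>0"
      using rate_le[OF that] \<theta> by linarith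
    have bound: "a \<le> ereal (r ^ k) * Gam Q \<Phi> w \<alpha> (x 0)" if "r > 0" for a r k
      using that by (simp add: inf)
    have "a \<le> ereal \<alpha> * Gam Q \<Phi> w \<alpha> (x 0) * ereal (?\<theta> ^ k)" for a k
      using \<theta> alpha_pos by (simp add: inf)
    with bound[OF \<theta>] bound[OF pos] show ?thesis by blast
  next
    case True
    have xh: "x k \<in> edom h" for k
      using True iterates_edom_h by (cases k) auto
    have Gam: "Gam Q \<Phi> w \<alpha> (x k) = ereal (gam (x k))" for k
      by (rule Gam_eq[OF iterates_interior xh])
    have gam: "gam (x k) \<le> ?\<theta> ^ k * gam (x 0)" for k
      by (rule gam_rate[OF True step])
    have phi: "phi (x k) - phi_opt \<le> ?\<theta> ^ k * gam (x 0)" for k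
    proof -
      have "phi (x k) - phi_opt \<le> gam (x k)"
        using dist_opt_nonneg[OF iterates_interior] alpha_pos by (simp add: gam_def)
      then show ?thesis using gam[of k] by linarith
    qed
    \<comment> \<open>The extra factor \<theta> from \<open>dist_opt_le_gam\<close> accounts for the
      exponent k + 1.\<close>
    have dist: "dist_opt (x k) \<le> \<alpha> * gam (x 0) * ?\<theta> ^ (k + 1)" for k
    proof -
      have "dist_opt (x k) \<le> \<alpha> * (?\<theta> * gam (x k))"
        by (rule dist_opt_le_gam[OF iterates_interior xh])
      also have "\<dots> \<le> \<alpha> * (?\<theta> * (?\<theta> ^ k * gam (x 0)))"
        by (intro mult_left_mono gam) (use \<theta> alpha_pos in auto)
      finally show ?thesis by (simp add: mult_ac)
    qed
    have gam0: "gam (x k) \<le> (1 - 1 / ((l (\<tau> + 1) * (L / \<mu>) + 1) * real (\<tau> + 1))) ^ k * gam (x 0)"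
      if "\<alpha> = \<alpha>0" for k
    proof -
      have "?\<theta> ^ k * gam (x 0) \<le> (1 - 1 / ((l (\<tau> + 1) * (L / \<mu>) + 1) * real (\<tau> + 1))) ^ k * gam (x 0)"
        using rate_le[OF that] \<theta> gam_nonneg[OF iterates_interior True]
        by (intro mult_right_mono power_mono) auto
      then show ?thesis using gam[of k] by linarith
    qed
    note eqs = Gam Phi_eq[OF intw_subset[OF iterates_interior] xh] opt_value_eq
      breg_dist_to_eq[OF iterates_interior] ereal_minus times_ereal.simps ereal_less_eq
    have last: "Gam Q \<Phi> w \<alpha>0 (x k)
        \<le> ereal ((1 - 1 / ((l (\<tau> + 1) * (L / \<mu>) + 1) * real (\<tau> + 1))) ^ k) * Gam Q \<Phi> w \<alpha>0 (x 0)"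
      if "\<alpha> = \<alpha>0" for k
      using gam0[OF that] unfolding that[symmetric] by (simp only: eqs)
    from gam phi dist show ?thesis
      by (simp only: eqs simp_thms) (intro allI impI last)
  qed
qed

end
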